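(* Suppose that $\mathcal{L}:\mathcal{C}\to Y^*$ is continuous (dual norm topology on $Y^*$), $\mathcal{L}\circ c\in L^2(\Omega;Y^* )$, $c:\Omega\to\mathcal{C}$ is measurable, and $c$ is $\mathbb{P}$-essentially separably valued. If $u\in L^2(\Omega;X)$ satisfies $\mathcal{A}_{c(\omega)}u(\omega)=\mathcal{L}_{c(\omega)}$ in $Y^*$ almost surely (i.e. $u$ solves the second-order moment variational formulation), then $u$ solves the stochastic variational formulation, i.e. $\mathfrak{A}u=\mathfrak{L}$ in $L^2(\Omega;Y)^*$.
   Context: $(\Omega,\mathcal{F},\mathbb{P})$ is a complete probability space; $X$ and $Y$ are separable Banach spaces over $\mathbb{F}\in\{\mathbb{R},\mathbb{C}\}$; $Y^*$ is the dual of $Y$ (functionals being linear, or antilinear throughout in the sesquilinear setting); $B(X,Y^* )$ is the space of bounded linear maps $X\to Y^*$; $\mathcal{C}$ is a topological space. Maps $c:\Omega\to\mathcal{C}$, $\mathcal{A}:\mathcal{C}\to B(X,Y^* )$, $\mathcal{L}:\mathcal{C}\to Y^*$ are given, and $\mathcal{A}_{c(\omega)}:=(\mathcal{A}\circ c)(\omega)$, $\mathcal{L}_{c(\omega)}:=(\mathcal{L}\circ c)(\omega)$. Topological spaces carry their Borel $\sigma$-algebras, "almost surely" means for $\mathbb{P}$-almost every $\omega$, and $L^p(\Omega;V)$ is the Bochner space. A function $h:\Omega\to S$ into a topological space is $\mathbb{P}$-essentially separably valued if there is $E\in\mathcal{F}$ with $\mathbb{P}(E)=1$ such that $h(E)$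 is contained in a separable subset of $S$. For $v\in L^2(\Omega;Y)$, $$[\mathfrak{A}(u)](v)=\int_\Omega[\mathcal{A}_{c(\omega)}u(\omega)](v(\omega))\,d\mathbb{P}(\omega),\qquad\mathfrak{L}(v)=\int_\Omega\mathcal{L}_{c(\omega)}(v(\omega))\,d\mathbb{P}(\omega).$$ The equality $\mathfrak{A}u=\mathfrak{L}$ in $L^2(\Omega;Y)^*$ means that these integrals exist for every $v\in L^2(\Omega;Y)$, define the same bounded functional on $L^2(\Omega;Y)$, i.e. $[\mathfrak{A}u](v)=\mathfrak{L}(v)$ for all $v\in L^2(\Omega;Y)$. *)

theory Defs
  imports "HOL-Probability.Probability"
begin

(* Scalars. The scalar field is a type 'f of sort {real_normed_field, euclidean_space}. Both real
   and complex are of this sort, and they are the only examples up to isomorphism, since a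
   finite-dimensional commutative real division algebra is R or C.
   Because z * conj z = |z|^2, conjugation can be defined uniformly: it is the identity on real
   and cnj on complex. *)
definition conj_scalar :: "'f::{real_normed_field, euclidean_space} \<Rightarrow> 'f"
  where "conj_scalar z = of_real ((norm z)\<^sup>2) / z"

lemma conj_scalar_real: "conj_scalar (x::real) = x"
  by (simp add: conj_scalar_def power2_eq_square)

lemma conj_scalar_complex: "conj_scalar (z::complex) = cnj z"
proof -
  have "complex_of_real ((norm z)\<^sup>2) = z * cnj z"
    by (rule complex_norm_square)
  then show ?thesis
    by (cases "z = 0") (simp_all only: conj_scalar_def, simp_all)
qed

(* An 'f-normed space structure on the real normed space 'v, extending its real one. With
   'v::banach this is a Banach space over 'f. *)
locale normed_space_over = vector_space scale
  for scale :: "'f::{real_normed_field, euclidean_space} \<Rightarrow> 'v::real_normed_vector \<Rightarrow> 'v" +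
  assumes norm_scale: "norm (scale a x) = norm a * norm x"
    and scale_of_real: "scale (of_real r) x = r *\<^sub>R x"

(* The dual Y* as a closed subspace of the bounded real-linear maps 'y \<Rightarrow>\<^sub>L 'f, whose norm
   restricts to the dual norm. The functionals are linear for twist = id and antilinear for
   twist = conj_scalar. The 'f-multiplication on Y* is pointwise in both cases. *)
definition dual_space ::
  "('f \<Rightarrow> 'f) \<Rightarrow> ('f \<Rightarrow> 'y \<Rightarrow> 'y) \<Rightarrow>
    ('y::real_normed_vector \<Rightarrow>\<^sub>L 'f::{real_normed_field, euclidean_space}) set"
  where "dual_space twist scaleY =
    {\<phi>. \<forall>a y. blinfun_apply \<phi> (scaleY a y) = twist a * blinfun_apply \<phi> y}"

(* The last clause is T (a x) = a (T x) in the dual of Y, evaluated at y. *)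
definition bounded_ops_to_dual ::
  "('f \<Rightarrow> 'f) \<Rightarrow> ('f \<Rightarrow> 'x \<Rightarrow> 'x) \<Rightarrow> ('f \<Rightarrow> 'y \<Rightarrow> 'y) \<Rightarrow>
    ('x::real_normed_vector \<Rightarrow>\<^sub>L 'y::real_normed_vector \<Rightarrow>\<^sub>L 'f::{real_normed_field, euclidean_space}) set"
  where "bounded_ops_to_dual twist scaleX scaleY =
    {T. (\<forall>x. blinfun_apply T x \<in> dual_space twist scaleY) \<and>
        (\<forall>a x y. blinfun_apply (blinfun_apply T (scaleX a x)) y
                 = a * blinfun_apply (blinfun_apply T x) y)}"

(* Representatives of the elements of the Bochner space L^2(M; V), for a closed subspace V.
   V may be non-separable (e.g. a dual), so measurability means strong measurability: almost
   everywhere the limit of V-valued simple functions. *)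
definition strongly_measurable_into ::
  "'w measure \<Rightarrow> 'v::real_normed_vector set \<Rightarrow> ('w \<Rightarrow> 'v) \<Rightarrow> bool"
  where "strongly_measurable_into M V f \<longleftrightarrow>
    f \<in> space M \<rightarrow> V \<and>
    (\<exists>s. (\<forall>i. simple_function M (s i) \<and> s i \<in> space M \<rightarrow> V) \<and>
         (AE \<omega> in M. (\<lambda>i::nat. s i \<omega>) \<longlonglongrightarrow> f \<omega>))"

definition bochner_L2 :: "'w measure \<Rightarrow> 'v::real_normed_vector set \<Rightarrow> ('w \<Rightarrow> 'v) set"
  where "bochner_L2 M V =
    {f. strongly_measurable_into M V f \<and> integrable M (\<lambda>\<omega>. (norm (f \<omega>))\<^sup>2)}"

definition bochner_L2_norm :: "'w measure \<Rightarrow> ('w \<Rightarrow> 'v::real_normed_vector) \<Rightarrow> real"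
  where "bochner_L2_norm M f = sqrt (\<integral>\<omega>. (norm (f \<omega>))\<^sup>2 \<partial>M)"

(* The dual of L^2(M; Y), as functionals on representatives; linearity and boundedness force them to respect
   almost everywhere equality. *)
definition is_bounded_functional_on_L2 ::
  "('f \<Rightarrow> 'f) \<Rightarrow> ('f \<Rightarrow> 'y \<Rightarrow> 'y) \<Rightarrow> 'w measure \<Rightarrow>
    (('w \<Rightarrow> 'y::real_normed_vector) \<Rightarrow> 'f::{real_normed_field, euclidean_space}) \<Rightarrow> bool"
  where "is_bounded_functional_on_L2 twist scaleY M \<Phi> \<longleftrightarrow>
    (\<forall>v\<in>bochner_L2 M UNIV. \<forall>w\<in>bochner_L2 M UNIV. \<Phi> (\<lambda>\<omega>. v \<omega> + w \<omega>) = \<Phi> v + \<Phi> w) \<and>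
    (\<forall>a. \<forall>v\<in>bochner_L2 M UNIV. \<Phi> (\<lambda>\<omega>. scaleY a (v \<omega>)) = twist a * \<Phi> v) \<and>
    (\<exists>K. \<forall>v\<in>bochner_L2 M UNIV. norm (\<Phi> v) \<le> K * bochner_L2_norm M v)"

definition ess_separably_valued :: "'w measure \<Rightarrow> ('w \<Rightarrow> 's::topological_space) \<Rightarrow> bool"
  where "ess_separably_valued M h \<longleftrightarrow>
    (\<exists>E\<in>sets M. measure M E = 1 \<and> (\<exists>S. separable_space (top_of_set S) \<and> h ` E \<subseteq> S))"

definition stoch_form ::
  "'w measure \<Rightarrow> ('w \<Rightarrow> 'c) \<Rightarrow>
    ('c \<Rightarrow> 'x::real_normed_vector \<Rightarrow>\<^sub>L 'y::real_normed_vector \<Rightarrow>\<^sub>L 'f::{real_normed_field, euclidean_space}) \<Rightarrow>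
    ('w \<Rightarrow> 'x) \<Rightarrow> ('w \<Rightarrow> 'y) \<Rightarrow> 'f"
  where "stoch_form M c A u v =
    (\<integral>\<omega>. blinfun_apply (blinfun_apply (A (c \<omega>)) (u \<omega>)) (v \<omega>) \<partial>M)"

definition stoch_load ::
  "'w measure \<Rightarrow> ('w \<Rightarrow> 'c) \<Rightarrow>
    ('c \<Rightarrow> 'y::real_normed_vector \<Rightarrow>\<^sub>L 'f::{real_normed_field, euclidean_space}) \<Rightarrow> ('w \<Rightarrow> 'y) \<Rightarrow> 'f"
  where "stoch_load M c L v = (\<integral>\<omega>. blinfun_apply (L (c \<omega>)) (v \<omega>) \<partial>M)"

definition solves_second_moment ::
  "'w measure \<Rightarrow> ('w \<Rightarrow> 'c) \<Rightarrow>
    ('c \<Rightarrow> 'x::real_normed_vector \<Rightarrow>\<^sub>L 'y::real_normed_vector \<Rightarrow>\<^sub>L 'f::{real_normed_field, euclidean_space}) \<Rightarrow>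
    ('c \<Rightarrow> 'y \<Rightarrow>\<^sub>L 'f) \<Rightarrow> ('w \<Rightarrow> 'x) \<Rightarrow> bool"
  where "solves_second_moment M c A L u \<longleftrightarrow>
    u \<in> bochner_L2 M UNIV \<and> (AE \<omega> in M. blinfun_apply (A (c \<omega>)) (u \<omega>) = L (c \<omega>))"

(* The integrals are required to exist explicitly, because a Bochner integral of a non-integrable
   function is 0 by convention. *)
definition solves_stochastic ::
  "('f \<Rightarrow> 'f) \<Rightarrow> ('f \<Rightarrow> 'y \<Rightarrow> 'y) \<Rightarrow> 'w measure \<Rightarrow> ('w \<Rightarrow> 'c) \<Rightarrow>
    ('c \<Rightarrow> 'x::real_normed_vector \<Rightarrow>\<^sub>L 'y::real_normed_vector \<Rightarrow>\<^sub>L 'f::{real_normed_field, euclidean_space}) \<Rightarrow>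
    ('c \<Rightarrow> 'y \<Rightarrow>\<^sub>L 'f) \<Rightarrow> ('w \<Rightarrow> 'x) \<Rightarrow> bool"
  where "solves_stochastic twist scaleY M c A L u \<longleftrightarrow>
    u \<in> bochner_L2 M UNIV \<and>
    (\<forall>v\<in>bochner_L2 M UNIV.
        integrable M (\<lambda>\<omega>. blinfun_apply (blinfun_apply (A (c \<omega>)) (u \<omega>)) (v \<omega>)) \<and>
        integrable M (\<lambda>\<omega>. blinfun_apply (L (c \<omega>)) (v \<omega>))) \<and>
    is_bounded_functional_on_L2 twist scaleY M (stoch_form M c A u) \<and>
    is_bounded_functional_on_L2 twist scaleY M (stoch_load M c L) \<and>
    (\<forall>v\<in>bochner_L2 M UNIV. stoch_form M c A u v = stoch_load M c L v)"

end

theory Submission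
  imports Defs
begin

text \<open>
  Write \<open>g = L \<circ> c\<close> and \<open>f \<omega> = A (c \<omega>) (u \<omega>)\<close>. The operator enters only through two facts: \<open>f\<close>
  takes its values in the dual of \<open>Y\<close>, and \<open>f = g\<close> almost surely. Nothing is assumed about
  the measurability of \<open>A\<close>; since \<open>g\<close> is in \<open>L\<^sup>2\<close> of the dual of \<open>Y\<close>, completeness of the
  measure puts \<open>f\<close> in the same space (\<open>bochner_L2_cong_AE\<close>).

  It remains to see that every \<open>f\<close> in \<open>L\<^sup>2\<close> of the dual acts on \<open>L\<^sup>2(M; Y)\<close> by integration. The
  pointwise pairing \<open>f \<omega> (v \<omega>)\<close> is almost surely the limit of pairings of simple functions,
  hence measurable (\<open>measurable_pairing\<close>). It is dominated by \<open>norm (f \<omega>) * norm (v \<omega>)\<close>,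
  which is integrable with integral at most the product of the \<open>L\<^sup>2\<close> norms, by Cauchy-Schwarz
  (\<open>integral_norm_mult_le_bochner_L2\<close>); so the pairing is a bounded functional
  (\<open>bounded_functional_pairing\<close>). The functionals of \<open>f\<close> and \<open>g\<close> agree because their
  integrands agree almost surely.
\<close>

lemma (in complete_measure) measurable_cong_AE_complete:
  assumes f: "f \<in> M \<rightarrow>\<^sub>M N" and ae: "AE x in M. g x = f x" and g: "g \<in> space M \<rightarrow> space N"
  shows "g \<in> M \<rightarrow>\<^sub>M N"
proof (rule measurableI)
  fix B assume "B \<in> sets N"
  then have "f -` B \<inter> space M \<in> sets M"
    using f by (rule measurable_sets[rotated])
  moreover have "AE x in M. x \<in> f -` B \<inter> space M \<longleftrightarrow> x \<in> g -` B \<inter> space M"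
    using ae by eventually_elim auto
  ultimately show "g -` B \<inter> space M \<in> sets M"
    using in_sets_AE[of "f -` B \<inter> space M" "g -` B \<inter> space M"] by blast
qed (use g in auto)

lemma (in complete_measure) borel_measurable_AE_LIMSEQ:
  fixes f :: "'a \<Rightarrow> 'b::{second_countable_topology, banach}"
  assumes s: "\<And>i::nat. s i \<in> borel_measurable M"
    and lim: "AE x in M. (\<lambda>i. s i x) \<longlonglongrightarrow> f x"
  shows "f \<in> borel_measurable M"
proof (rule measurable_cong_AE_complete)
  show "(\<lambda>x. lim (\<lambda>i. s i x)) \<in> borel_measurable M"
    using s by (rule borel_measurable_lim_metric)
  show "AE x in M. f x = lim (\<lambda>i. s i x)"
    using lim by eventually_elim (simp add: limI)
qed auto

text \<open>
  Representatives in \<open>bochner_L2\<close> must take their values in \<open>V\<close> everywhere, so this is required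
  of \<open>f\<close> separately.
\<close>

lemma (in complete_measure) bochner_L2_cong_AE:
  assumes g: "g \<in> bochner_L2 M V" and ae: "AE \<omega> in M. f \<omega> = g \<omega>"
    and f: "f \<in> space M \<rightarrow> V"
  shows "f \<in> bochner_L2 M V"
proof -
  obtain s where s: "\<And>i. simple_function M (s i)" "\<And>i. s i \<in> space M \<rightarrow> V"
      "AE \<omega> in M. (\<lambda>i::nat. s i \<omega>) \<longlonglongrightarrow> g \<omega>"
    and int: "integrable M (\<lambda>\<omega>. (norm (g \<omega>))\<^sup>2)"
    using g unfolding bochner_L2_def strongly_measurable_into_def by blast
  have "AE \<omega> in M. (\<lambda>i. s i \<omega>) \<longlonglongrightarrow> f \<omega>"
    using s(3) ae by eventually_elim simp
  then have "strongly_measurable_into M V f"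
    using s f unfolding strongly_measurable_into_def by blast
  moreover have ae2: "AE \<omega> in M. (norm (f \<omega>))\<^sup>2 = (norm (g \<omega>))\<^sup>2"
    using ae by eventually_elim simp
  moreover have "(\<lambda>\<omega>. (norm (f \<omega>))\<^sup>2) \<in> borel_measurable M"
    using borel_measurable_integrable[OF int] ae2
    by (rule measurable_cong_AE_complete) auto
  ultimately show ?thesis
    using int integrable_cong_AE[of "\<lambda>\<omega>. (norm (f \<omega>))\<^sup>2" M "\<lambda>\<omega>. (norm (g \<omega>))\<^sup>2"]
    by (auto simp: bochner_L2_def)
qed

text \<open>
  Strong measurability yields limits only almost everywhere, so over a measure that need not be
  complete the measurability of the norm is read off from that of its square.
\<close>

lemma borel_measurable_norm_bochner_L2:
  assumes "f \<in> bochner_L2 M V"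
  shows "(\<lambda>\<omega>. norm (f \<omega>)) \<in> borel_measurable M"
proof -
  have "(\<lambda>\<omega>. (norm (f \<omega>))\<^sup>2) \<in> borel_measurable M"
    using assms by (auto simp: bochner_L2_def)
  then have "(\<lambda>\<omega>. sqrt ((norm (f \<omega>))\<^sup>2)) \<in> borel_measurable M"
    by measurable
  then show ?thesis
    by simp
qed

lemma integral_norm_mult_le_bochner_L2:
  assumes f: "f \<in> bochner_L2 M V" and g: "g \<in> bochner_L2 M W"
  shows "integrable M (\<lambda>\<omega>. norm (f \<omega>) * norm (g \<omega>))"
    and "(\<integral>\<omega>. norm (f \<omega>) * norm (g \<omega>) \<partial>M) \<le> bochner_L2_norm M f * bochner_L2_norm M g"
proof -
  note [measurable] = borel_measurable_norm_bochner_L2[OF f] borel_measurable_norm_bochner_L2[OF g]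
  have f2: "integrable M (\<lambda>\<omega>. (norm (f \<omega>))\<^sup>2)" and g2: "integrable M (\<lambda>\<omega>. (norm (g \<omega>))\<^sup>2)"
    using f g by (auto simp: bochner_L2_def)
  have le: "norm (f \<omega>) * norm (g \<omega>) \<le> (norm (f \<omega>))\<^sup>2 + (norm (g \<omega>))\<^sup>2" for \<omega>
    using sum_squares_bound[of "norm (f \<omega>)" "norm (g \<omega>)"]
      mult_nonneg_nonneg[OF norm_ge_zero norm_ge_zero, of "f \<omega>" "g \<omega>"] by linarith
  show int: "integrable M (\<lambda>\<omega>. norm (f \<omega>) * norm (g \<omega>))"
    by (rule Bochner_Integration.integrable_bound[OF Bochner_Integration.integrable_add[OF f2 g2]])
      (simp_all add: le)
  have "(\<integral>\<omega>. norm (f \<omega>) * norm (g \<omega>) \<partial>M)\<^sup>2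
      \<le> (\<integral>\<omega>. (norm (f \<omega>))\<^sup>2 \<partial>M) * (\<integral>\<omega>. (norm (g \<omega>))\<^sup>2 \<partial>M)"
  proof -
    \<comment> \<open>Transfer of the Cauchy-Schwarz inequality from nonnegative integrals to Bochner integrals.\<close>
    have "ennreal ((\<integral>\<omega>. norm (f \<omega>) * norm (g \<omega>) \<partial>M)\<^sup>2)
        = (\<integral>\<^sup>+\<omega>. ennreal (norm (f \<omega>) * norm (g \<omega>)) \<partial>M)\<^sup>2"
      by (subst nn_integral_eq_integral[OF int]) (simp_all add: ennreal_power)
    also have "\<dots> = (\<integral>\<^sup>+\<omega>. ennreal (norm (f \<omega>)) * ennreal (norm (g \<omega>)) \<partial>M)\<^sup>2"
      by (simp only: ennreal_mult norm_ge_zero)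
    also have "\<dots> \<le> (\<integral>\<^sup>+\<omega>. (ennreal (norm (f \<omega>)))\<^sup>2 \<partial>M) * (\<integral>\<^sup>+\<omega>. (ennreal (norm (g \<omega>)))\<^sup>2 \<partial>M)"
      by (rule Cauchy_Schwarz_nn_integral) measurable
    also have "\<dots> = (\<integral>\<^sup>+\<omega>. ennreal ((norm (f \<omega>))\<^sup>2) \<partial>M) * (\<integral>\<^sup>+\<omega>. ennreal ((norm (g \<omega>))\<^sup>2) \<partial>M)"
      by (simp only: ennreal_power norm_ge_zero)
    also have "\<dots> = ennreal (\<integral>\<omega>. (norm (f \<omega>))\<^sup>2 \<partial>M) * ennreal (\<integral>\<omega>. (norm (g \<omega>))\<^sup>2 \<partial>M)"
      by (subst nn_integral_eq_integral[OF f2], simp, subst nn_integral_eq_integral[OF g2], simp_all)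
    also have "\<dots> = ennreal ((\<integral>\<omega>. (norm (f \<omega>))\<^sup>2 \<partial>M) * (\<integral>\<omega>. (norm (g \<omega>))\<^sup>2 \<partial>M))"
      by (rule ennreal_mult[symmetric]) simp_all
    finally show ?thesis
      by (subst (asm) ennreal_le_iff) simp_all
  qed
  then show "(\<integral>\<omega>. norm (f \<omega>) * norm (g \<omega>) \<partial>M) \<le> bochner_L2_norm M f * bochner_L2_norm M g"
    unfolding bochner_L2_norm_def
    by (simp add: real_le_rsqrt flip: real_sqrt_mult)
qed

text \<open>
  Continuity of the pairing alone does not reduce this to Borel measurability of \<open>f\<close> and \<open>v\<close>,
  as the Borel sets of a product with a non-separable factor may exceed the product
  \<open>\<sigma>\<close>-algebra. The approximation by simple functions avoids the product.
\<close>

lemma (in complete_measure) measurable_pairing: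
  fixes f :: "'a \<Rightarrow> 'y::real_normed_vector \<Rightarrow>\<^sub>L 'f::euclidean_space"
  assumes f: "strongly_measurable_into M V f" and v: "strongly_measurable_into M W v"
  shows "(\<lambda>\<omega>. blinfun_apply (f \<omega>) (v \<omega>)) \<in> borel_measurable M"
proof -
  obtain s where s: "\<And>i. simple_function M (s i)" "AE \<omega> in M. (\<lambda>i::nat. s i \<omega>) \<longlonglongrightarrow> f \<omega>"
    using f unfolding strongly_measurable_into_def by blast
  obtain t where t: "\<And>i. simple_function M (t i)" "AE \<omega> in M. (\<lambda>i::nat. t i \<omega>) \<longlonglongrightarrow> v \<omega>"
    using v unfolding strongly_measurable_into_def by blast
  show ?thesis
  proof (rule borel_measurable_AE_LIMSEQ)
    show "(\<lambda>\<omega>. blinfun_apply (s i \<omega>) (t i \<omega>)) \<in> borel_measurable M" for i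
      by (rule borel_measurable_simple_function[OF simple_function_compose2[OF s(1) t(1)]])
    show "AE \<omega> in M. (\<lambda>i. blinfun_apply (s i \<omega>) (t i \<omega>)) \<longlonglongrightarrow> blinfun_apply (f \<omega>) (v \<omega>)"
      using s(2) t(2) by eventually_elim (rule blinfun.tendsto)
  qed
qed

lemma (in complete_measure) integrable_pairing:
  fixes f :: "'a \<Rightarrow> 'y::real_normed_vector \<Rightarrow>\<^sub>L 'f::euclidean_space"
  assumes f: "f \<in> bochner_L2 M V" and v: "v \<in> bochner_L2 M W"
  shows "integrable M (\<lambda>\<omega>. blinfun_apply (f \<omega>) (v \<omega>))"
proof (rule Bochner_Integration.integrable_bound)
  show "integrable M (\<lambda>\<omega>. norm (f \<omega>) * norm (v \<omega>))"
    using f v by (rule integral_norm_mult_le_bochner_L2(1))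
  show "(\<lambda>\<omega>. blinfun_apply (f \<omega>) (v \<omega>)) \<in> borel_measurable M"
    using f v by (auto simp: bochner_L2_def intro: measurable_pairing)
qed (auto simp: abs_mult norm_blinfun)

lemma (in complete_measure) bounded_functional_pairing:
  fixes f :: "'a \<Rightarrow> 'y::real_normed_vector \<Rightarrow>\<^sub>L 'f::{real_normed_field, euclidean_space}"
  assumes f: "f \<in> bochner_L2 M (dual_space twist scaleY)"
  shows "is_bounded_functional_on_L2 twist scaleY M (\<lambda>v. \<integral>\<omega>. blinfun_apply (f \<omega>) (v \<omega>) \<partial>M)"
  unfolding is_bounded_functional_on_L2_def
proof (intro conjI ballI allI exI)
  fix v :: "'a \<Rightarrow> 'y" assume v: "v \<in> bochner_L2 M UNIV"
  note int_v = integrable_pairing[OF f v]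
  show "(\<integral>\<omega>. blinfun_apply (f \<omega>) (v \<omega> + w \<omega>) \<partial>M)
      = (\<integral>\<omega>. blinfun_apply (f \<omega>) (v \<omega>) \<partial>M) + (\<integral>\<omega>. blinfun_apply (f \<omega>) (w \<omega>) \<partial>M)"
    if "w \<in> bochner_L2 M UNIV" for w
    using int_v integrable_pairing[OF f that] by (simp add: blinfun.add_right)
  show "(\<integral>\<omega>. blinfun_apply (f \<omega>) (scaleY a (v \<omega>)) \<partial>M)
      = twist a * (\<integral>\<omega>. blinfun_apply (f \<omega>) (v \<omega>) \<partial>M)" for a
  proof -
    have "(\<integral>\<omega>. blinfun_apply (f \<omega>) (scaleY a (v \<omega>)) \<partial>M)
        = (\<integral>\<omega>. twist a * blinfun_apply (f \<omega>) (v \<omega>) \<partial>M)"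
      using f by (intro Bochner_Integration.integral_cong)
        (auto simp: bochner_L2_def strongly_measurable_into_def dual_space_def)
    then show ?thesis
      using int_v by simp
  qed
  have "norm (\<integral>\<omega>. blinfun_apply (f \<omega>) (v \<omega>) \<partial>M) \<le> (\<integral>\<omega>. norm (blinfun_apply (f \<omega>) (v \<omega>)) \<partial>M)"
    by (rule integral_norm_bound)
  also have "\<dots> \<le> (\<integral>\<omega>. norm (f \<omega>) * norm (v \<omega>) \<partial>M)"
    by (intro integral_mono Bochner_Integration.integrable_norm int_v
        integral_norm_mult_le_bochner_L2(1)[OF f v] norm_blinfun)
  also have "\<dots> \<le> bochner_L2_norm M f * bochner_L2_norm M v"
    by (rule integral_norm_mult_le_bochner_L2(2)[OF f v])
  finally show "norm (\<integral>\<omega>. blinfun_apply (f \<omega>) (v \<omega>) \<partial>M)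
      \<le> bochner_L2_norm M f * bochner_L2_norm M v" .
qed

theorem theorem2p8:
  fixes M :: "'w measure"
    and scaleX :: "'f::{real_normed_field, euclidean_space} \<Rightarrow> 'x::banach \<Rightarrow> 'x"
    and scaleY :: "'f \<Rightarrow> 'y::banach \<Rightarrow> 'y"
    and twist :: "'f \<Rightarrow> 'f"
    and c :: "'w \<Rightarrow> 'c::topological_space"
    and A :: "'c \<Rightarrow> 'x \<Rightarrow>\<^sub>L 'y \<Rightarrow>\<^sub>L 'f"
    and L :: "'c \<Rightarrow> 'y \<Rightarrow>\<^sub>L 'f"
    and u :: "'w \<Rightarrow> 'x"
  assumes prob: "prob_space M"
    and complete: "complete_measure M"
    and X: "normed_space_over scaleX"
    and sepX: "separable_space (euclidean :: 'x topology)"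
    and Y: "normed_space_over scaleY"
    and sepY: "separable_space (euclidean :: 'y topology)"
    and twist: "twist = id \<or> twist = conj_scalar"
    and A: "\<And>p. A p \<in> bounded_ops_to_dual twist scaleX scaleY"
    and L: "\<And>p. L p \<in> dual_space twist scaleY"
    and L_cont: "continuous_on UNIV L"
    and L_c: "L \<circ> c \<in> bochner_L2 M (dual_space twist scaleY)"
    and c_meas: "c \<in> borel_measurable M"
    and c_sep: "ess_separably_valued M c"
    and u_sol: "solves_second_moment M c A L u"
  shows "solves_stochastic twist scaleY M c A L u"
proof -
  interpret complete_measure M
    by (rule complete)
  \<comment> \<open>The operator is absorbed into a single dual-valued function.\<close>
  define f where "f = (\<lambda>\<omega>. blinfun_apply (A (c \<omega>)) (u \<omega>))"
  have u: "u \<in> bochner_L2 M UNIV" and ae: "AE \<omega> in M. f \<omega> = (L \<circ> c) \<omega>"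
    using u_sol by (auto simp: solves_second_moment_def f_def)
  have f: "f \<in> bochner_L2 M (dual_space twist scaleY)"
    using L_c ae by (rule bochner_L2_cong_AE) (use A in \<open>auto simp: f_def bounded_ops_to_dual_def\<close>)
  have form: "stoch_form M c A u = (\<lambda>v. \<integral>\<omega>. blinfun_apply (f \<omega>) (v \<omega>) \<partial>M)"
    by (rule ext) (simp add: stoch_form_def f_def)
  have load: "stoch_load M c L = (\<lambda>v. \<integral>\<omega>. blinfun_apply ((L \<circ> c) \<omega>) (v \<omega>) \<partial>M)"
    by (rule ext) (simp add: stoch_load_def)
  have "stoch_form M c A u v = stoch_load M c L v" if v: "v \<in> bochner_L2 M UNIV" for v
    unfolding form load
  proof (rule integral_cong_AE)
    show "AE \<omega> in M. blinfun_apply (f \<omega>) (v \<omega>) = blinfun_apply ((L \<circ> c) \<omega>) (v \<omega>)"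
      using ae by eventually_elim simp
  qed (use integrable_pairing[OF f v] integrable_pairing[OF L_c v] in auto)
  then show ?thesis
    using u integrable_pairing[OF f] integrable_pairing[OF L_c]
      bounded_functional_pairing[OF f] bounded_functional_pairing[OF L_c]
    unfolding solves_stochastic_def form load by (simp add: f_def)
qed

end
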